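(* Let $p$ be an odd prime, let $q,w\in\mathbb{C}_p$ with $|1-q|_p<1$ and $|1-w|_p<1$, and let $r\geq 1$ be an integer. Let $E_{n,w,q}^{(r)}$ be the $w$-$q$-Euler numbers of order $r$ and $G_{n,w,q}^{(r)}$ the $w$-$q$-Genocchi numbers of order $r$ (both defined in the context). Then for every integer $n\geq 0$, $$\frac{G_{n+r,w,q}^{(r)}}{r!\binom{n+r}{r}}=\int_{\mathbb{Z}_p}\cdots\int_{\mathbb{Z}_p}q^{-(x_1+\cdots+x_r)}w^{x_1+\cdots+x_r}[x_1+\cdots+x_r]_q^n\,d\mu_{-q}(x_1)\cdots d\mu_{-q}(x_r)=E_{n,w,q}^{(r)},$$ and $$G_{0,w,q}^{(r)}=G_{1,w,q}^{(r)}=\cdots=G_{r-1,w,q}^{(r)}=0.$$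
   Context: $\mathbb{C}_p$ is the completion of an algebraic closure of $\mathbb{Q}_p$, with absolute value normalized by $|p|_p=1/p$. For $u\in\mathbb{C}_p$ with $|1-u|_p<1$ and $x\in\mathbb{Z}_p$, $u^x=\sum_{k\ge 0}\binom{x}{k}(u-1)^k$. Notation: $[x]_q=\frac{1-q^x}{1-q}$ (with $[x]_1=x$). For a uniformly differentiable function $f:\mathbb{Z}_p\to\mathbb{C}_p$ (the difference quotient $\frac{f(x)-f(y)}{x-y}$ has a limit as $(x,y)\to(a,a)$ for every $a\in\mathbb{Z}_p$), the invariant $p$-adic $q$-integral is $$\int_{\mathbb{Z}_p}f(x)\,d\mu_{-q}(x)=\lim_{N\to\infty}\frac{1+q}{1+q^{p^N}}\sum_{x=0}^{p^N-1}f(x)(-q)^x.$$ Multiple integrals are iterated ($r$-fold). The $w$-$q$-Euler numbers of order $r$ are defined, for $n\ge 0$, by $$E_{n,w,q}^{(r)}=\int_{\mathbb{Z}_p}\cdots\int_{\mathbb{Z}_p}w^{x_1+\cdots+x_r}[x_1+\cdots+x_r]_q^n\,q^{-(x_1+\cdots+x_r)}\,d\mu_{-q}(x_1)\cdots d\mu_{-q}(x_r).$$ The $w$-$q$-Genocchi numbers of order $r$ are defined by the following identity of formal power series in $t$ (the exponential is expanded in powers of $t$ and integrated coefficientwise): $$\sum_{n=0}^{\infty}G_{n,w,q}^{(r)}\frac{t^n}{n!}=t^r\int_{\mathbb{Z}_p}\cdots\int_{\mathbb{Z}_p}q^{-(x_1+\cdots+x_r)}w^{x_1+\cdots+x_r}e^{[x_1+\cdots+x_r]_qt}\,d\mu_{-q}(x_1)\cdots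 d\mu_{-q}(x_r).$$ *)

theory Defs
  imports
    "HOL-Analysis.Analysis"
    "HOL-Computational_Algebra.Formal_Power_Series"
    "HOL-Algebra.Algebraic_Closure_Type"
begin

text \<open>
  The constant \<open>norm\<close> can only be used in real normed vector spaces, so the absolute value of a
  metric field is expressed as the distance from 0.
\<close>

definition padic_abs :: "'a :: {zero, metric_space} \<Rightarrow> real" where
  "padic_abs x = dist x 0"

text \<open>
  The libraries have no p-adic numbers. The field \<open>\<complex>\<^sub>p\<close> is only defined up to isometric
  isomorphism, as a completion of an algebraic closure of \<open>\<rat>\<^sub>p\<close>, so it is rendered as a type
  \<open>'a\<close> satisfying the following predicate, which says that \<open>'a\<close> is such a completion.
  Completeness is part of the sort of \<open>'a\<close>. The assumptions on the absolute value force it to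
  restrict to the usual p-adic one on \<open>\<rat>\<close>, and as \<open>'a\<close> is complete, \<open>closure \<rat>\<close> is the
  completion \<open>\<rat>\<^sub>p\<close> of \<open>\<rat>\<close>.
\<close>

locale padic_complex_field =
  fixes Cp :: "'a :: {field_char_0, complete_space} itself"
    and p :: nat
  assumes prime_p: "Factorial_Ring.prime p"
    and dist_abs: "dist (x :: 'a) y = padic_abs (x - y)"
    and abs_times: "padic_abs (x * y :: 'a) = padic_abs x * padic_abs y"
    and abs_ultrametric: "padic_abs (x + y :: 'a) \<le> max (padic_abs x) (padic_abs y)"
    and abs_p: "padic_abs (of_nat p :: 'a) = 1 / real p"
    and dense_algebraic_closure:
      "\<exists>A :: 'a set. algebraic_closure (ring_of_type_algebra \<lparr>carrier := A\<rparr>) (closure \<rat>)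
                   \<and> closure A = UNIV"

text \<open>
  The subring \<open>\<int>\<^sub>p\<close> of \<open>\<complex>\<^sub>p\<close> is the closure of the integers. A function on \<open>\<int>\<^sub>p\<close> is rendered as
  a function on \<open>'a\<close>; only its values at natural numbers enter the integral. Below, arguments \<open>x\<close>
  of \<open>padic_pow\<close> and \<open>q_number\<close> are meant to lie in \<open>\<int>\<^sub>p\<close>, and \<open>u\<close>, \<open>q\<close>, \<open>w\<close> in the open unit
  disc around 1. The integral is meant for functions that are uniformly differentiable on \<open>\<int>\<^sub>p\<close>;
  if the limit does not exist, its value is unspecified.
\<close>

definition padic_pow :: "'a :: {field_char_0, t2_space} \<Rightarrow> 'a \<Rightarrow> 'a" where
  "padic_pow u x = (\<Sum>k. (x gchoose k) * (u - 1) ^ k)"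

definition q_number :: "'a :: {field_char_0, t2_space} \<Rightarrow> 'a \<Rightarrow> 'a" where
  "q_number q x = (if q = 1 then x else (1 - padic_pow q x) / (1 - q))"

definition q_integral ::
    "nat \<Rightarrow> 'a :: {field_char_0, t2_space} \<Rightarrow> ('a \<Rightarrow> 'a) \<Rightarrow> 'a" where
  "q_integral p q f =
     lim (\<lambda>N. (1 + q) / (1 + q ^ (p ^ N)) * (\<Sum>x<p ^ N. f (of_nat x) * (- q) ^ x))"

text \<open>
  Iterated integral of a function of \<open>(x\<^sub>1, \<dots>, x\<^sub>r)\<close>, represented as a function on lists of length
  \<open>r\<close>; the innermost integration is over \<open>x\<^sub>1\<close> and the outermost over \<open>x\<^sub>r\<close>.
\<close>

fun multi_q_integral ::
    "nat \<Rightarrow> 'a :: {field_char_0, t2_space} \<Rightarrow> nat \<Rightarrow> ('a list \<Rightarrow> 'a) \<Rightarrow> 'a" where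
  "multi_q_integral p q 0 f = f []"
| "multi_q_integral p q (Suc r) f =
     q_integral p q (\<lambda>x. multi_q_integral p q r (\<lambda>xs. f (xs @ [x])))"

definition multi_q_integral_fps ::
    "nat \<Rightarrow> 'a :: {field_char_0, t2_space} \<Rightarrow> nat \<Rightarrow> ('a list \<Rightarrow> 'a fps) \<Rightarrow> 'a fps" where
  "multi_q_integral_fps p q r F =
     Abs_fps (\<lambda>n. multi_q_integral p q r (\<lambda>xs. fps_nth (F xs) n))"

definition wq_euler ::
    "nat \<Rightarrow> 'a :: {field_char_0, t2_space} \<Rightarrow> 'a \<Rightarrow> nat \<Rightarrow> nat \<Rightarrow> 'a" where
  "wq_euler p w q r n =
     multi_q_integral p q r
       (\<lambda>xs. padic_pow w (sum_list xs) * q_number q (sum_list xs) ^ n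
             * padic_pow q (- sum_list xs))"

definition wq_genocchi_fps ::
    "nat \<Rightarrow> 'a :: {field_char_0, t2_space} \<Rightarrow> 'a \<Rightarrow> nat \<Rightarrow> 'a fps" where
  "wq_genocchi_fps p w q r =
     fps_X ^ r * multi_q_integral_fps p q r
       (\<lambda>xs. fps_const (padic_pow q (- sum_list xs) * padic_pow w (sum_list xs))
             * fps_exp (q_number q (sum_list xs)))"

definition wq_genocchi ::
    "nat \<Rightarrow> 'a :: {field_char_0, t2_space} \<Rightarrow> 'a \<Rightarrow> nat \<Rightarrow> nat \<Rightarrow> 'a" where
  "wq_genocchi p w q r n = fact n * fps_nth (wq_genocchi_fps p w q r) n"

text \<open>These numbers are the unique solution of the defining generating function identity:\<close>

lemma wq_genocchi_unique:
  "Abs_fps (\<lambda>n. G n / fact n) = wq_genocchi_fps p w q r \<longleftrightarrow> G = wq_genocchi p w q r"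
  by (auto simp: fps_eq_iff fun_eq_iff wq_genocchi_def field_simps)

end

theory Submission
  imports Defs
begin

text \<open>
  Extracting coefficients from the generating function reduces everything to pulling the factor
  \<open>1 / n!\<close> out of the iterated integral, which is legitimate only if all the limits involved
  exist. Only values at natural numbers enter the integrals, and there the integrand is a function
  of \<open>s = x\<^sub>1 + \<dots> + x\<^sub>r\<close> in the span of the functions \<open>s\<^sup>n u\<^sup>s\<close> with
  \<open>\<bar>1 - u\<bar>\<^sub>p < 1\<close>. This span is closed under products and, by the binomial theorem, under
  integration of translates. The integral of \<open>s\<^sup>n u\<^sup>s\<close> exists because summation by parts expresses
  \<open>(v - 1) \<Sum>\<^sub>x\<^sub><\<^sub>M x\<^sup>n v\<^sup>x\<close> with \<open>v = - u q\<close> by the same sums of smaller degree, where \<open>v - 1\<close> is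
  a unit because \<open>p\<close> is odd, and because \<open>(u q)\<^sup>M\<close> tends to \<open>1\<close> along \<open>M = p\<^sup>N\<close>.
\<close>

context padic_complex_field
begin

section \<open>The ultrametric absolute value and the open unit disc around 1\<close>

abbreviation pabs :: "'a \<Rightarrow> real" where "pabs \<equiv> padic_abs"

lemma pabs_nonneg [simp]: "0 \<le> pabs x"
  by (simp add: padic_abs_def)

lemma pabs_eq_0_iff [simp]: "pabs x = 0 \<longleftrightarrow> x = 0"
  by (simp add: padic_abs_def)

lemma pabs_0 [simp]: "pabs 0 = 0"
  by simp

lemma pabs_1 [simp]: "pabs 1 = 1"
  using abs_times[of 1 1] by (metis mult_cancel_left1 mult_1 pabs_eq_0_iff zero_neq_one)

lemma pabs_minus_commute: "pabs (x - y) = pabs (y - x)"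
  by (metis dist_abs dist_commute)

lemma pabs_uminus [simp]: "pabs (- x) = pabs x"
  using pabs_minus_commute[of 0 x] by simp

lemma pabs_diff_le: "pabs (x - y) \<le> max (pabs x) (pabs y)"
  using abs_ultrametric[of x "- y"] by simp

lemma pabs_power: "pabs (x ^ n) = pabs x ^ n"
  by (induction n) (simp_all add: abs_times)

lemma pabs_inverse: "pabs (inverse x) = inverse (pabs x)"
proof (cases "x = 0")
  case False
  then have "pabs x * pabs (inverse x) = 1"
    by (simp flip: abs_times)
  then show ?thesis
    by (simp add: inverse_unique)
qed auto

lemma pabs_sum_le:
  assumes "\<And>i. i \<in> A \<Longrightarrow> pabs (f i) \<le> B" and "0 \<le> B"
  shows "pabs (\<Sum>i\<in>A. f i) \<le> B"
  using assms(1)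
proof (induction A rule: infinite_finite_induct)
  case (insert i A)
  then show ?case
    using abs_ultrametric[of "f i" "sum f A"] by fastforce
qed (use assms(2) in simp_all)

lemma pabs_of_nat_le_1: "pabs (of_nat n) \<le> 1"
proof (induction n)
  case (Suc n)
  then show ?case
    using abs_ultrametric[of 1 "of_nat n"] by simp
qed simp

lemma pabs_eq_1:
  assumes "pabs (1 - u) < 1"
  shows "pabs u = 1"
proof -
  have "pabs u \<le> 1"
    using pabs_diff_le[of 1 "1 - u"] assms by simp
  moreover have "1 \<le> pabs u"
    using abs_ultrametric[of "1 - u" u] assms by simp
  ultimately show ?thesis by simp
qed

text \<open>Together with the rule for \<open>inverse\<close> below, this makes the open unit disc
  around 1 a group, so bases such as \<open>u * q\<close> and \<open>inverse q\<close> remain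
  admissible.\<close>

lemma pabs_1_minus_mult_less_1:
  assumes "pabs (1 - u) < 1" and "pabs (1 - v) < 1"
  shows "pabs (1 - u * v) < 1"
proof -
  have "pabs (1 - u * v) = pabs ((1 - u) + u * (1 - v))"
    by (simp add: algebra_simps)
  also have "\<dots> \<le> max (pabs (1 - u)) (pabs (1 - v))"
    using abs_ultrametric[of "1 - u" "u * (1 - v)"] pabs_eq_1[OF assms(1)] by (simp add: abs_times)
  finally show ?thesis using assms by simp
qed

lemma pabs_1_minus_inverse_less_1:
  assumes "pabs (1 - u) < 1"
  shows "pabs (1 - inverse u) < 1"
proof -
  have u: "pabs u = 1" by (rule pabs_eq_1) fact
  then have "u \<noteq> 0" by auto
  then have "1 - inverse u = - (inverse u * (1 - u))"
    by (simp add: field_simps)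
  then show ?thesis
    using assms u by (simp add: abs_times pabs_inverse)
qed

text \<open>If 2 had absolute value below 1, then so would \<open>1 = p - 2 * k\<close>, because
  both terms would.\<close>

lemma pabs_2_eq_1:
  assumes "odd p"
  shows "pabs 2 = 1"
proof -
  obtain k where k: "p = 2 * k + 1" using assms by (rule oddE)
  have "(1 :: 'a) = of_nat p - 2 * of_nat k" by (simp add: k)
  then have "1 \<le> max (pabs (of_nat p)) (pabs (2 * of_nat k))"
    by (metis pabs_1 pabs_diff_le)
  moreover have "pabs (of_nat p) < 1"
    using prime_gt_1_nat[OF prime_p] by (simp add: abs_p)
  moreover have "pabs (2 * of_nat k) \<le> pabs 2"
    using mult_left_mono[OF pabs_of_nat_le_1[of k] pabs_nonneg[of 2]] by (simp add: abs_times)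
  ultimately have "1 \<le> pabs 2" by linarith
  then show ?thesis using pabs_of_nat_le_1[of 2] by simp
qed

text \<open>Since \<open>2 = (1 + u) + (1 - u)\<close> is a unit and \<open>1 - u\<close> is small,
  \<open>1 + u\<close> cannot be small. This keeps the denominators \<open>1 + q ^ (p ^ N)\<close>
  away from 0.\<close>

lemma pabs_1_plus_eq_1:
  assumes "odd p" and "pabs (1 - u) < 1"
  shows "pabs (1 + u) = 1"
proof (rule antisym)
  show "pabs (1 + u) \<le> 1"
    using abs_ultrametric[of 1 u] pabs_eq_1[OF assms(2)] by simp
  show "1 \<le> pabs (1 + u)"
    using abs_ultrametric[of "1 + u" "1 - u"] pabs_2_eq_1[OF assms(1)] assms(2) by simp
qed

subsection \<open>Limits\<close>

lemma tendsto_pabs_iff: "(f \<longlongrightarrow> L) F \<longleftrightarrow> ((\<lambda>N. pabs (f N - L)) \<longlongrightarrow> 0) F"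
  by (subst tendsto_dist_iff) (simp add: dist_abs)

text \<open>The sort of \<open>'a\<close> does not tie the metric to the field operations, so the
  limit laws below come from the axioms on the absolute value, by bounding the distance to the
  limit.\<close>

lemma tendsto_pabs_bound:
  assumes "\<And>N. pabs (f N - L) \<le> b N" and "(b \<longlongrightarrow> 0) F"
  shows "(f \<longlongrightarrow> L) F"
  unfolding tendsto_pabs_iff
  by (rule tendsto_sandwich[OF _ _ tendsto_const assms(2)]) (simp_all add: assms(1))

lemma tendsto_add_padic:
  fixes f g :: "'b \<Rightarrow> 'a"
  assumes "(f \<longlongrightarrow> L) F" and "(g \<longlongrightarrow> M) F"
  shows "((\<lambda>N. f N + g N) \<longlongrightarrow> L + M) F"
proof (rule tendsto_pabs_bound)
  show "pabs (f N + g N - (L + M)) \<le> max (pabs (f N - L)) (pabs (g N - M))" for N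
    using abs_ultrametric[of "f N - L" "g N - M"] by (simp add: algebra_simps)
  show "((\<lambda>N. max (pabs (f N - L)) (pabs (g N - M))) \<longlongrightarrow> 0) F"
    using tendsto_max[OF assms[unfolded tendsto_pabs_iff]] by simp
qed

lemma tendsto_mult_padic:
  fixes f g :: "'b \<Rightarrow> 'a"
  assumes "(f \<longlongrightarrow> L) F" and "(g \<longlongrightarrow> M) F"
  shows "((\<lambda>N. f N * g N) \<longlongrightarrow> L * M) F"
proof (rule tendsto_pabs_bound)
  let ?x = "\<lambda>N. pabs (f N - L)" and ?y = "\<lambda>N. pabs (g N - M)"
  show "pabs (f N * g N - L * M) \<le> ?x N * ?y N + (?x N * pabs M + pabs L * ?y N)" for N
  proof -
    have le: "pabs (a + b) \<le> pabs a + pabs b" for a b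
      using abs_ultrametric[of a b] pabs_nonneg[of a] pabs_nonneg[of b] by linarith
    have "f N * g N - L * M = (f N - L) * (g N - M) + ((f N - L) * M + L * (g N - M))"
      by (simp add: algebra_simps)
    then show ?thesis
      using le[of "(f N - L) * (g N - M)" "(f N - L) * M + L * (g N - M)"]
        le[of "(f N - L) * M" "L * (g N - M)"] by (simp add: abs_times)
  qed
  show "((\<lambda>N. ?x N * ?y N + (?x N * pabs M + pabs L * ?y N)) \<longlongrightarrow> 0) F"
    using assms[unfolded tendsto_pabs_iff] by (auto intro!: tendsto_eq_intros)
qed

lemma tendsto_cmult_padic:
  fixes f :: "'b \<Rightarrow> 'a"
  shows "(f \<longlongrightarrow> L) F \<Longrightarrow> ((\<lambda>N. c * f N) \<longlongrightarrow> c * L) F"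
  by (rule tendsto_mult_padic[OF tendsto_const])

lemma tendsto_diff_padic:
  fixes f g :: "'b \<Rightarrow> 'a"
  assumes "(f \<longlongrightarrow> L) F" and "(g \<longlongrightarrow> M) F"
  shows "((\<lambda>N. f N - g N) \<longlongrightarrow> L - M) F"
  using tendsto_add_padic[OF assms(1) tendsto_cmult_padic[OF assms(2), of "- 1"]] by simp

lemma tendsto_sum_padic:
  fixes f :: "'c \<Rightarrow> 'b \<Rightarrow> 'a"
  assumes "\<And>i. i \<in> A \<Longrightarrow> (f i \<longlongrightarrow> L i) F"
  shows "((\<lambda>N. \<Sum>i\<in>A. f i N) \<longlongrightarrow> (\<Sum>i\<in>A. L i)) F"
  using assms by (induction A rule: infinite_finite_induct) (auto intro: tendsto_add_padic)

lemma tendsto_power_padic: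
  fixes f :: "'b \<Rightarrow> 'a"
  shows "(f \<longlongrightarrow> L) F \<Longrightarrow> ((\<lambda>N. f N ^ n) \<longlongrightarrow> L ^ n) F"
  by (induction n) (auto intro: tendsto_mult_padic)

lemma tendsto_p_power: "(\<lambda>N. of_nat (p ^ N) :: 'a) \<longlonglongrightarrow> 0"
proof (rule tendsto_pabs_bound)
  show "pabs (of_nat (p ^ N) - 0) \<le> (1 / real p) ^ N" for N
    by (simp add: pabs_power abs_p)
  show "(\<lambda>N. (1 / real p) ^ N) \<longlonglongrightarrow> 0"
    using prime_gt_1_nat[OF prime_p] by (intro LIMSEQ_realpow_zero) auto
qed

section \<open>Powers with exponent \<open>p ^ N\<close>\<close>

lemma pabs_power_minus_1_le:
  assumes "pabs (1 - u) < 1"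
  shows "pabs (u ^ n - 1) \<le> pabs (1 - u)"
proof -
  have "pabs (u ^ n - 1) = pabs (u - 1) * pabs (\<Sum>i<n. u ^ i)"
    by (simp add: power_diff_1_eq abs_times)
  moreover have "pabs (\<Sum>i<n. u ^ i) \<le> 1"
    by (rule pabs_sum_le) (simp_all add: pabs_power pabs_eq_1[OF assms])
  ultimately show ?thesis
    using mult_left_le by (metis pabs_minus_commute pabs_nonneg)
qed

text \<open>In \<open>u ^ p - 1 = (u - 1) * (\<Sum>i<p. u ^ i)\<close> each summand is within
  \<open>pabs (1 - u)\<close> of 1, so the sum is that close to \<open>p\<close>. Raising to the
  power \<open>p\<close> thus contracts the distance to 1.\<close>

lemma pabs_power_p_minus_1_le:
  assumes "pabs (1 - u) < 1"
  shows "pabs (u ^ p - 1) \<le> pabs (u - 1) * max (1 / real p) (pabs (1 - u))"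
proof -
  have "(\<Sum>i<p. u ^ i) = of_nat p + (\<Sum>i<p. u ^ i - 1)"
    by (simp add: sum_subtractf)
  moreover have "pabs (\<Sum>i<p. u ^ i - 1) \<le> pabs (1 - u)"
    by (rule pabs_sum_le) (simp_all add: pabs_power_minus_1_le assms)
  ultimately have "pabs (\<Sum>i<p. u ^ i) \<le> max (1 / real p) (pabs (1 - u))"
    using abs_ultrametric[of "of_nat p" "\<Sum>i<p. u ^ i - 1"] abs_p by force
  then show ?thesis
    by (simp add: power_diff_1_eq abs_times mult_left_mono)
qed

lemma tendsto_power_p_power:
  assumes "pabs (1 - u) < 1"
  shows "(\<lambda>N. u ^ (p ^ N)) \<longlonglongrightarrow> 1"
proof (rule tendsto_pabs_bound)
  \<comment> \<open>Powers of \<open>u\<close> are no farther from 1 than \<open>u\<close> itself,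
    so the contraction factor of the first step serves for all later ones.\<close>
  define c where "c = max (1 / real p) (pabs (1 - u))"
  show "pabs (u ^ (p ^ N) - 1) \<le> c ^ N" for N
  proof (induction N)
    case 0
    then show ?case using assms pabs_minus_commute[of u 1] by simp
  next
    case (Suc N)
    let ?v = "u ^ (p ^ N)"
    have v: "pabs (1 - ?v) \<le> pabs (1 - u)"
      using pabs_power_minus_1_le[OF assms] pabs_minus_commute by metis
    have "pabs (u ^ (p ^ Suc N) - 1) = pabs (?v ^ p - 1)"
      by (simp add: mult.commute flip: power_mult)
    also have "\<dots> \<le> pabs (?v - 1) * max (1 / real p) (pabs (1 - ?v))"
      using v assms by (intro pabs_power_p_minus_1_le) linarith
    also have "\<dots> \<le> c ^ N * c"
      using v by (intro mult_mono Suc.IH) (auto simp: c_def le_max_iff_disj)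
    finally show ?case by (simp add: mult.commute)
  qed
  have "0 \<le> c" "c < 1"
    using assms prime_gt_1_nat[OF prime_p] by (auto simp: c_def le_max_iff_disj)
  then show "(\<lambda>N. c ^ N) \<longlonglongrightarrow> 0"
    by (rule LIMSEQ_realpow_zero)
qed

subsection \<open>Powers with integer exponents\<close>

lemma padic_pow_of_nat: "padic_pow u (of_nat n) = (u :: 'a) ^ n"
proof -
  have "(\<lambda>k. (of_nat n gchoose k) * (u - 1) ^ k) sums
          (\<Sum>k\<le>n. (of_nat n gchoose k) * (u - 1) ^ k)"
    by (rule sums_finite) (simp_all flip: binomial_gbinomial)
  also have "(\<Sum>k\<le>n. (of_nat n gchoose k) * (u - 1) ^ k) = ((u - 1) + 1) ^ n"
    by (subst binomial_ring) (simp flip: binomial_gbinomial)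
  finally show ?thesis
    by (simp add: padic_pow_def sums_iff)
qed

text \<open>Induction on \<open>n\<close> through the partial sums. The claim is about
  \<open>sums\<close> rather than the value of the series, because the induction step has to hand on
  convergence as well.\<close>

lemma padic_pow_sums_uminus_of_nat:
  assumes "pabs (1 - u) < 1"
  shows "(\<lambda>k. (- of_nat n gchoose k) * (u - 1) ^ k) sums (inverse u ^ n)"
proof (induction n)
  case 0
  have "(\<lambda>k. (0 gchoose k) * (u - 1) ^ k) sums (\<Sum>k\<in>{0}. (0 gchoose k) * (u - 1) ^ k)"
    by (rule sums_finite) (auto simp: gbinomial_0_left)
  then show ?case by simp
next
  case (Suc n)
  let ?c = "\<lambda>n k. (- of_nat n :: 'a) gchoose k"
  define P where "P = (\<lambda>n K. \<Sum>k<K. ?c n k * (u - 1) ^ k)"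
  have u: "u \<noteq> 0" using pabs_eq_1[OF assms] by auto
  have pascal: "?c n (Suc k) = ?c (Suc n) k + ?c (Suc n) (Suc k)" for k
    using gbinomial_Suc_Suc[of "- of_nat (Suc n) :: 'a" k] by simp
  \<comment> \<open>Pascal's rule is multiplication of the series by \<open>u = 1 + (u - 1)\<close>;
    cutting off after finitely many terms leaves one boundary term.\<close>
  have "P n (Suc K) = u * P (Suc n) K + ?c (Suc n) K * (u - 1) ^ K" for K
  proof (induction K)
    case 0
    then show ?case by (simp add: P_def)
  next
    case (Suc K)
    have "P n (Suc (Suc K)) = P n (Suc K) + ?c n (Suc K) * (u - 1) ^ Suc K"
      by (simp add: P_def)
    moreover have "P (Suc n) (Suc K) = P (Suc n) K + ?c (Suc n) K * (u - 1) ^ K"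
      by (simp add: P_def)
    ultimately show ?case
      by (simp only: Suc.IH pascal power_Suc) (simp add: algebra_simps)
  qed
  then have P: "P (Suc n) K = inverse u * (P n (Suc K) - ?c (Suc n) K * (u - 1) ^ K)" for K
    using u by (simp add: field_simps)
  \<comment> \<open>The boundary term vanishes in the limit: its coefficient is an integer, hence of
    absolute value at most 1.\<close>
  have "(\<lambda>K. ?c (Suc n) K * (u - 1) ^ K) \<longlonglongrightarrow> 0"
  proof (rule tendsto_pabs_bound)
    show "pabs (?c (Suc n) K * (u - 1) ^ K - 0) \<le> pabs (u - 1) ^ K" for K
    proof -
      have "?c (Suc n) K = (- 1) ^ K * of_nat ((n + K) choose K)"
        using gbinomial_minus[of "of_nat (Suc n) :: 'a" K]
        by (simp add: binomial_gbinomial add.commute)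
      then have "pabs (?c (Suc n) K) \<le> 1"
        using pabs_of_nat_le_1 by (simp add: abs_times pabs_power)
      then show ?thesis
        by (simp add: abs_times pabs_power mult_left_le_one_le)
    qed
    show "(\<lambda>K. pabs (u - 1) ^ K) \<longlonglongrightarrow> 0"
      using assms pabs_minus_commute[of u 1] by (intro LIMSEQ_realpow_zero) auto
  qed
  moreover have "(\<lambda>K. P n (Suc K)) \<longlonglongrightarrow> inverse u ^ n"
    using Suc.IH unfolding sums_def P_def by (rule LIMSEQ_Suc)
  ultimately have "P (Suc n) \<longlonglongrightarrow> inverse u * (inverse u ^ n - 0)"
    unfolding P[abs_def] by (intro tendsto_cmult_padic tendsto_diff_padic)
  then show ?case
    by (simp add: sums_def P_def)
qed

lemma padic_pow_uminus_of_nat: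
  "pabs (1 - u) < 1 \<Longrightarrow> padic_pow u (- of_nat n) = inverse u ^ n"
  unfolding padic_pow_def by (rule sums_unique[symmetric]) (rule padic_pow_sums_uminus_of_nat)

subsection \<open>Exponential polynomials\<close>

text \<open>The span of the functions \<open>k ^ n * u ^ k\<close>, given inductively so that linear
  claims reduce to these generators. The domain is \<open>nat\<close> because the integrals only see
  values at natural numbers.\<close>

inductive exp_poly :: "(nat \<Rightarrow> 'a) \<Rightarrow> bool" where
  monom: "pabs (1 - u) < 1 \<Longrightarrow> exp_poly (\<lambda>k. of_nat k ^ n * u ^ k)"
| cmult: "exp_poly f \<Longrightarrow> exp_poly (\<lambda>k. c * f k)"
| add: "exp_poly f \<Longrightarrow> exp_poly g \<Longrightarrow> exp_poly (\<lambda>k. f k + g k)"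

lemma exp_poly_power_base: "pabs (1 - u) < 1 \<Longrightarrow> exp_poly (\<lambda>k. u ^ k)"
  using exp_poly.monom[of u 0] by simp

lemma exp_poly_const: "exp_poly (\<lambda>_. c)"
  using exp_poly.cmult[OF exp_poly_power_base[of 1], of c] by simp

lemma exp_poly_of_nat: "exp_poly of_nat"
  using exp_poly.monom[of 1 1] by simp

lemma exp_poly_sum:
  assumes "finite A" and "\<And>i. i \<in> A \<Longrightarrow> exp_poly (f i)"
  shows "exp_poly (\<lambda>k. \<Sum>i\<in>A. f i k)"
  using assms by (induction A rule: finite_induct) (auto intro: exp_poly_const exp_poly.add)

text \<open>By bilinearity it suffices to multiply two generators: exponents add and bases
  multiply.\<close>

lemma exp_poly_mult:
  assumes "exp_poly f" and "exp_poly g"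
  shows "exp_poly (\<lambda>k. f k * g k)"
  using assms
proof (induction f rule: exp_poly.induct)
  case (monom u n)
  note u = monom.hyps
  from monom.prems show ?case
  proof (induction g rule: exp_poly.induct)
    case (monom v m)
    then show ?case
      using exp_poly.monom[OF pabs_1_minus_mult_less_1[OF u], of v "n + m"]
      by (simp add: power_add power_mult_distrib mult_ac)
  next
    case (cmult g c)
    then show ?case
      using exp_poly.cmult[of "\<lambda>k. of_nat k ^ n * u ^ k * g k" c] by (simp add: mult_ac)
  next
    case (add g h)
    then show ?case
      using exp_poly.add by (simp add: distrib_left)
  qed
next
  case (cmult f c)
  then show ?case
    using exp_poly.cmult[of "\<lambda>k. f k * g k" c] by (simp add: mult_ac)
next
  case (add f h)
  then show ?case
    using exp_poly.add by (simp add: distrib_right)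
qed

lemma exp_poly_power: "exp_poly f \<Longrightarrow> exp_poly (\<lambda>k. f k ^ n)"
  by (induction n) (auto intro: exp_poly_const exp_poly_mult)

lemma exp_poly_q_number:
  assumes "pabs (1 - q) < 1"
  shows "exp_poly (\<lambda>k. q_number q (of_nat k))"
proof (cases "q = 1")
  case True
  then show ?thesis by (simp add: q_number_def exp_poly_of_nat)
next
  case False
  have "exp_poly (\<lambda>k. inverse (1 - q) * (1 + (- 1) * q ^ k))"
    by (intro exp_poly.cmult exp_poly.add exp_poly_const exp_poly_power_base assms)
  then show ?thesis
    using False by (simp add: q_number_def padic_pow_of_nat field_simps)
qed

subsection \<open>Integration of exponential polynomials\<close>

definition q_integral_seq :: "'a \<Rightarrow> (nat \<Rightarrow> 'a) \<Rightarrow> nat \<Rightarrow> 'a" where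
  "q_integral_seq q f N = (1 + q) / (1 + q ^ (p ^ N)) * (\<Sum>x<p ^ N. f x * (- q) ^ x)"

lemma q_integral_eq_lim: "q_integral p q f = lim (q_integral_seq q (\<lambda>k. f (of_nat k)))"
  by (simp add: q_integral_def q_integral_seq_def[abs_def])

lemma q_integral_seq_cmult: "q_integral_seq q (\<lambda>k. c * f k) N = c * q_integral_seq q f N"
  by (simp add: q_integral_seq_def sum_distrib_left mult_ac)

lemma q_integral_seq_add:
  "q_integral_seq q (\<lambda>k. f k + g k) N = q_integral_seq q f N + q_integral_seq q g N"
  by (simp add: q_integral_seq_def sum.distrib distrib_left distrib_right)

lemma q_integral_seq_sum:
  "q_integral_seq q (\<lambda>k. \<Sum>i\<in>A. f i k) N = (\<Sum>i\<in>A. q_integral_seq q (f i) N)"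
  by (simp add: q_integral_seq_def sum_distrib_left sum_distrib_right) (rule sum.swap)

text \<open>Summation by parts: the differences of \<open>x ^ n * v ^ x\<close> telescope to the
  boundary terms, and expanding \<open>(x + 1) ^ n\<close> leaves only lower powers besides
  \<open>x ^ n\<close>. The term \<open>0 ^ n\<close> is the boundary value at 0, which is 1 for
  \<open>n = 0\<close>.\<close>

lemma sum_of_nat_power_mult_power:
  fixes v :: "'b :: comm_ring_1"
  shows "(v - 1) * (\<Sum>x<M. of_nat x ^ n * v ^ x) =
     of_nat M ^ n * v ^ M - 0 ^ n - v * (\<Sum>j<n. of_nat (n choose j) * (\<Sum>x<M. of_nat x ^ j * v ^ x))"
proof (induction M)
  case 0
  then show ?case by simp
next
  case (Suc M)
  have "of_nat (Suc M) ^ n = (of_nat M + 1 :: 'b) ^ n" by (simp add: add.commute)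
  also have "\<dots> = (\<Sum>j<n. of_nat (n choose j) * of_nat M ^ j) + of_nat M ^ n"
    by (subst binomial_ring) (simp flip: lessThan_Suc_atMost)
  finally have "of_nat (Suc M) ^ n * v ^ Suc M
      = v * (\<Sum>j<n. of_nat (n choose j) * (of_nat M ^ j * v ^ M)) + v * (of_nat M ^ n * v ^ M)"
    by (simp add: distrib_left distrib_right sum_distrib_left sum_distrib_right mult_ac)
  then show ?case
    by (simp add: Suc.IH sum.distrib distrib_left) (simp add: algebra_simps)
qed

lemma convergent_sum_of_nat_power_mult_power:
  assumes "odd p" and u: "pabs (1 - u) < 1"
  shows "convergent (\<lambda>N. \<Sum>x<p ^ N. of_nat x ^ n * (- u) ^ x)"
proof (induction n rule: less_induct)
  case (less n)
  let ?T = "\<lambda>n N. \<Sum>x<p ^ N. of_nat x ^ n * (- u) ^ x"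
  have "\<forall>j. \<exists>L. j < n \<longrightarrow> ?T j \<longlonglongrightarrow> L"
    using less.IH by (auto simp: convergent_def)
  then obtain L where L: "\<And>j. j < n \<Longrightarrow> ?T j \<longlonglongrightarrow> L j"
    by metis
  \<comment> \<open>The sign survives because \<open>p ^ N\<close> is odd.\<close>
  have "(- u) ^ (p ^ N) = - 1 * u ^ (p ^ N)" for N
    using assms(1) by simp
  then have "(\<lambda>N. (- u) ^ (p ^ N)) \<longlonglongrightarrow> - 1 * 1"
    by (simp only:) (intro tendsto_cmult_padic tendsto_power_p_power u)
  \<comment> \<open>This is the summation by parts identity for \<open>v = - u\<close>, solved for
    the sum of degree \<open>n\<close>; all terms on its right have limits by induction.\<close>
  then have "(\<lambda>N. inverse (- u - 1) * (of_nat (p ^ N) ^ n * (- u) ^ (p ^ N) - 0 ^ n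
        - (- u) * (\<Sum>j<n. of_nat (n choose j) * ?T j N)))
      \<longlonglongrightarrow> inverse (- u - 1) * (0 ^ n * (- 1 * 1) - 0 ^ n - (- u) * (\<Sum>j<n. of_nat (n choose j) * L j))"
    by (intro tendsto_cmult_padic tendsto_diff_padic tendsto_mult_padic tendsto_power_padic
          tendsto_p_power tendsto_const tendsto_sum_padic L) auto
  moreover have "inverse (- u - 1) * (of_nat (p ^ N) ^ n * (- u) ^ (p ^ N) - 0 ^ n
        - (- u) * (\<Sum>j<n. of_nat (n choose j) * ?T j N)) = ?T n N" for N
  proof -
    have "- u - 1 \<noteq> 0"
    proof
      assume "- u - 1 = 0"
      then have "1 + u = 0" by (metis add.commute eq_iff_diff_eq_0 right_minus)
      then show False using pabs_1_plus_eq_1[OF assms] by simp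
    qed
    then show ?thesis
      by (simp only: sum_of_nat_power_mult_power[symmetric]) (simp flip: mult.assoc)
  qed
  ultimately show ?case
    unfolding convergent_def by auto
qed

lemma convergent_q_integral_seq_monom:
  assumes "odd p" and q: "pabs (1 - q) < 1" and u: "pabs (1 - u) < 1"
  shows "convergent (q_integral_seq q (\<lambda>k. of_nat k ^ n * u ^ k))"
proof -
  obtain L where L: "(\<lambda>N. \<Sum>x<p ^ N. of_nat x ^ n * (- (u * q)) ^ x) \<longlonglongrightarrow> L"
    using convergent_sum_of_nat_power_mult_power[OF assms(1) pabs_1_minus_mult_less_1[OF u q]]
    by (auto simp: convergent_def)
  have 2: "pabs 2 = 1" by (rule pabs_2_eq_1) fact
  \<comment> \<open>Both \<open>1 + q ^ (p ^ N)\<close> and 2 are units, so their inverses are as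
    close as they are.\<close>
  have "(\<lambda>N. inverse (1 + q ^ (p ^ N))) \<longlonglongrightarrow> inverse 2"
  proof (rule tendsto_pabs_bound)
    show "pabs (inverse (1 + q ^ (p ^ N)) - inverse 2) \<le> pabs (q ^ (p ^ N) - 1)" for N
    proof -
      have "pabs (1 - q ^ (p ^ N)) < 1"
        using pabs_power_minus_1_le[OF q] q by (metis order_le_less_trans pabs_minus_commute)
      then have a: "pabs (1 + q ^ (p ^ N)) = 1"
        by (rule pabs_1_plus_eq_1[OF assms(1)])
      then have "1 + q ^ (p ^ N) \<noteq> 0" by auto
      then have "inverse (1 + q ^ (p ^ N)) - inverse 2
          = inverse (1 + q ^ (p ^ N)) * inverse 2 * - (q ^ (p ^ N) - 1)"
        by (simp add: field_simps)
      then show ?thesis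
        by (simp only: abs_times pabs_inverse a 2 pabs_uminus) simp
    qed
    show "(\<lambda>N. pabs (q ^ (p ^ N) - 1)) \<longlonglongrightarrow> 0"
      using tendsto_power_p_power[OF q] by (simp add: tendsto_pabs_iff)
  qed
  then have "(\<lambda>N. (1 + q) * inverse (1 + q ^ (p ^ N))
        * (\<Sum>x<p ^ N. of_nat x ^ n * (- (u * q)) ^ x)) \<longlonglongrightarrow> (1 + q) * inverse 2 * L"
    by (intro tendsto_mult_padic tendsto_const L)
  moreover have "(- (u * q)) ^ x = u ^ x * (- q) ^ x" for x
    by (metis mult_minus_right power_mult_distrib)
  then have "q_integral_seq q (\<lambda>k. of_nat k ^ n * u ^ k) =
      (\<lambda>N. (1 + q) * inverse (1 + q ^ (p ^ N)) * (\<Sum>x<p ^ N. of_nat x ^ n * (- (u * q)) ^ x))"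
    by (simp only: q_integral_seq_def[abs_def] divide_inverse mult.assoc)
  ultimately show ?thesis
    by (simp only: convergentI)
qed

text \<open>Existence of the limit alone would not survive iteration. As a function of the
  translation \<open>m\<close>, the integral is again an exponential polynomial, so the next
  integration can proceed.\<close>

lemma ex_exp_poly_integral_translate:
  assumes "odd p" and q: "pabs (1 - q) < 1" and "exp_poly f"
  shows "\<exists>h. exp_poly h \<and> (\<forall>m. q_integral_seq q (\<lambda>k. f (k + m)) \<longlonglongrightarrow> h m)"
  using assms(3)
proof (induction f rule: exp_poly.induct)
  case (monom u n)
  obtain I where I: "\<And>j. q_integral_seq q (\<lambda>k. of_nat k ^ j * u ^ k) \<longlonglongrightarrow> I j"
    using convergent_q_integral_seq_monom[OF assms(1) q monom] unfolding convergent_def by metis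
  \<comment> \<open>The binomial expansion of \<open>(k + m) ^ n * u ^ (k + m)\<close>, with each
    \<open>k ^ j * u ^ k\<close> replaced by its integral \<open>I j\<close>.\<close>
  define h where "h = (\<lambda>m. \<Sum>j\<le>n. (of_nat (n choose j) * I j) * (of_nat m ^ (n - j) * u ^ m))"
  have "exp_poly h"
    unfolding h_def by (intro exp_poly_sum exp_poly.cmult exp_poly.monom monom) auto
  moreover have "q_integral_seq q (\<lambda>k. of_nat (k + m) ^ n * u ^ (k + m)) \<longlonglongrightarrow> h m" for m
  proof -
    let ?c = "\<lambda>j. of_nat (n choose j) * of_nat m ^ (n - j) * u ^ m"
    have "of_nat (k + m) ^ n * u ^ (k + m) = (\<Sum>j\<le>n. ?c j * (of_nat k ^ j * u ^ k))" for k
      by (simp add: binomial_ring power_add sum_distrib_left sum_distrib_right mult_ac)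
    then have "q_integral_seq q (\<lambda>k. of_nat (k + m) ^ n * u ^ (k + m))
        = (\<lambda>N. \<Sum>j\<le>n. ?c j * q_integral_seq q (\<lambda>k. of_nat k ^ j * u ^ k) N)"
      by (simp only: q_integral_seq_sum q_integral_seq_cmult fun_eq_iff) simp
    moreover have "\<dots> \<longlonglongrightarrow> (\<Sum>j\<le>n. ?c j * I j)"
      by (intro tendsto_sum_padic tendsto_cmult_padic I)
    ultimately show ?thesis
      by (simp add: h_def mult_ac)
  qed
  ultimately show ?case by blast
next
  case (cmult f c)
  then obtain h where "exp_poly h" "\<And>m. q_integral_seq q (\<lambda>k. f (k + m)) \<longlonglongrightarrow> h m"
    by blast
  then show ?case
    by (intro exI[of _ "\<lambda>m. c * h m"])
       (auto simp: q_integral_seq_cmult[abs_def] intro: exp_poly.cmult tendsto_cmult_padic)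
next
  case (add f g)
  then obtain h h' where
    "exp_poly h" "\<And>m. q_integral_seq q (\<lambda>k. f (k + m)) \<longlonglongrightarrow> h m"
    "exp_poly h'" "\<And>m. q_integral_seq q (\<lambda>k. g (k + m)) \<longlonglongrightarrow> h' m"
    by blast
  then show ?case
    by (intro exI[of _ "\<lambda>m. h m + h' m"])
       (auto simp: q_integral_seq_add[abs_def] intro: exp_poly.add tendsto_add_padic)
qed

section \<open>Iterated integrals of functions of the sum of the variables\<close>

definition integral_translate :: "'a \<Rightarrow> (nat \<Rightarrow> 'a) \<Rightarrow> nat \<Rightarrow> 'a" where
  "integral_translate q f m = lim (q_integral_seq q (\<lambda>k. f (k + m)))"

text \<open>A divergent sequence has an unspecified \<open>lim\<close>, so a scalar can be pulled
  out only once the limit is known to exist; the function \<open>h\<close> provides it.\<close>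

lemma
  assumes "odd p" and "pabs (1 - q) < 1" and "exp_poly f"
  shows exp_poly_integral_translate: "exp_poly (integral_translate q f)"
    and integral_translate_cmult:
      "integral_translate q (\<lambda>k. c * f k) = (\<lambda>m. c * integral_translate q f m)"
proof -
  obtain h where h: "exp_poly h" "\<And>m. q_integral_seq q (\<lambda>k. f (k + m)) \<longlonglongrightarrow> h m"
    using ex_exp_poly_integral_translate[OF assms] by metis
  have eq: "integral_translate q f = h"
    by (rule ext) (simp add: integral_translate_def limI[OF h(2)])
  then show "exp_poly (integral_translate q f)" using h(1) by simp
  show "integral_translate q (\<lambda>k. c * f k) = (\<lambda>m. c * integral_translate q f m)"
    unfolding eq
    by (rule ext) (simp add: integral_translate_def q_integral_seq_cmult[abs_def]
                     limI[OF tendsto_cmult_padic[OF h(2)]])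
qed

text \<open>The outer variables are fixed while the inner ones are integrated, and they enter only
  through their sum. The offset \<open>m\<close> records that sum and must vary in the
  induction.\<close>

lemma multi_q_integral_eq_funpow:
  assumes "\<And>ks. f (map of_nat ks) = g (sum_list ks + m)"
  shows "multi_q_integral p q r f = (integral_translate q ^^ r) g m"
  using assms
proof (induction r arbitrary: f m)
  case 0
  then show ?case using 0[of "[]"] by simp
next
  case (Suc r)
  have "multi_q_integral p q r (\<lambda>xs. f (xs @ [of_nat k])) = (integral_translate q ^^ r) g (k + m)"
    for k
  proof (rule Suc.IH)
    show "f (map of_nat ks @ [of_nat k]) = g (sum_list ks + (k + m))" for ks
      using Suc.prems[of "ks @ [k]"] by (simp add: add.assoc)
  qed
  then show ?case
    by (simp add: q_integral_eq_lim integral_translate_def[of q "(integral_translate q ^^ r) g"])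
qed

text \<open>Both claims are proved at once: pulling \<open>c\<close> through one more integral
  requires the inner iterate to be an exponential polynomial.\<close>

lemma funpow_integral_translate_cmult:
  assumes "odd p" and "pabs (1 - q) < 1" and "exp_poly f"
  shows "exp_poly ((integral_translate q ^^ r) f) \<and>
    (integral_translate q ^^ r) (\<lambda>k. c * f k) = (\<lambda>m. c * (integral_translate q ^^ r) f m)"
  by (induction r)
     (simp_all add: assms exp_poly_integral_translate integral_translate_cmult)

lemma multi_q_integral_cmult:
  assumes "odd p" and "pabs (1 - q) < 1" and "exp_poly g"
    and f: "\<And>ks. f (map of_nat ks) = g (sum_list ks)"
  shows "multi_q_integral p q r (\<lambda>xs. c * f xs) = c * multi_q_integral p q r f"
proof -
  have "multi_q_integral p q r (\<lambda>xs. c * f xs) = (integral_translate q ^^ r) (\<lambda>k. c * g k) 0"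
    by (rule multi_q_integral_eq_funpow) (simp add: f)
  moreover have "multi_q_integral p q r f = (integral_translate q ^^ r) g 0"
    by (rule multi_q_integral_eq_funpow) (simp add: f)
  ultimately show ?thesis
    by (simp add: funpow_integral_translate_cmult[OF assms(1-3)])
qed

lemma multi_q_integral_euler_cmult:
  fixes q w :: 'a
  assumes "odd p" and q: "pabs (1 - q) < 1" and w: "pabs (1 - w) < 1"
  shows "multi_q_integral p q r (\<lambda>xs. c * (padic_pow q (- sum_list xs) * padic_pow w (sum_list xs)
             * q_number q (sum_list xs) ^ n))
       = c * multi_q_integral p q r (\<lambda>xs. padic_pow q (- sum_list xs) * padic_pow w (sum_list xs)
             * q_number q (sum_list xs) ^ n)"
proof (rule multi_q_integral_cmult[OF assms(1) q])
  have sum: "sum_list (map of_nat ks) = (of_nat (sum_list ks) :: 'a)" for ks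
    by (induction ks) auto
  \<comment> \<open>At natural numbers the p-adic powers in the integrand are ordinary powers, and
    \<open>q\<close> to the power \<open>- k\<close> is a power of \<open>inverse q\<close>.\<close>
  let ?g = "\<lambda>k. inverse q ^ k * w ^ k * q_number q (of_nat k) ^ n"
  show "exp_poly ?g"
    by (intro exp_poly_mult exp_poly_power exp_poly_q_number exp_poly_power_base
          pabs_1_minus_inverse_less_1 q w)
  show "padic_pow q (- sum_list (map of_nat ks)) * padic_pow w (sum_list (map of_nat ks))
          * q_number q (sum_list (map of_nat ks)) ^ n = ?g (sum_list ks)" for ks
    by (simp add: sum padic_pow_of_nat padic_pow_uminus_of_nat[OF q])
qed

end

theorem theorem4:
  fixes p r :: nat
    and q w :: "'a :: {field_char_0, complete_space}"
  assumes "padic_complex_field TYPE('a) p"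
    and "Factorial_Ring.prime p" and "odd p"
    and "padic_abs (1 - q) < 1" and "padic_abs (1 - w) < 1"
    and "r \<ge> 1"
  shows "(\<forall>n. wq_genocchi p w q r (n + r) / (fact r * of_nat ((n + r) choose r))
              = multi_q_integral p q r
                  (\<lambda>xs. padic_pow q (- sum_list xs) * padic_pow w (sum_list xs)
                        * q_number q (sum_list xs) ^ n)
            \<and> multi_q_integral p q r
                  (\<lambda>xs. padic_pow q (- sum_list xs) * padic_pow w (sum_list xs)
                        * q_number q (sum_list xs) ^ n)
              = wq_euler p w q r n)
       \<and> (\<forall>i<r. wq_genocchi p w q r i = 0)"
proof -
  interpret padic_complex_field "TYPE('a)" p by fact
  let ?f = "\<lambda>n xs. padic_pow q (- sum_list xs) * padic_pow w (sum_list xs)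
    * q_number q (sum_list xs) ^ n"
  have "wq_genocchi p w q r (n + r) / (fact r * of_nat ((n + r) choose r))
      = multi_q_integral p q r (?f n)" for n
  proof -
    \<comment> \<open>The factor \<open>fps_X ^ r\<close> shifts the index by \<open>r\<close>, and
      the exponential contributes \<open>1 / n!\<close> under the integral.\<close>
    have "wq_genocchi p w q r (n + r)
        = fact (n + r) * multi_q_integral p q r (\<lambda>xs. inverse (fact n) * ?f n xs)"
      by (simp add: wq_genocchi_def wq_genocchi_fps_def fps_X_power_mult_nth
            multi_q_integral_fps_def divide_inverse mult_ac)
    also have "\<dots> = fact (n + r) * inverse (fact n) * multi_q_integral p q r (?f n)"
      unfolding multi_q_integral_euler_cmult[OF assms(3-5)] by (simp only: mult.assoc)
    also have "fact (n + r) * inverse (fact n) = (fact r * of_nat ((n + r) choose r) :: 'a)"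
      by (simp add: binomial_fact field_simps)
    finally show ?thesis by simp
  qed
  moreover have "multi_q_integral p q r (?f n) = wq_euler p w q r n" for n
    by (simp add: wq_euler_def mult_ac)
  \<comment> \<open>Coefficients below degree \<open>r\<close> are killed by the factor
    \<open>fps_X ^ r\<close>.\<close>
  moreover have "wq_genocchi p w q r i = 0" if "i < r" for i
    using that by (simp add: wq_genocchi_def wq_genocchi_fps_def fps_X_power_mult_nth)
  ultimately show ?thesis by blast
qed

end
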